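(* Let $m \geq 3$ be an integer. The determinant of the Turk's Head link $THK(m,2)$ is the $m$th Pell number $P_m$, where $P_1 = 1$, $P_2 = 2$, and $P_m = 2P_{m-1} + P_{m-2}$ for $m \geq 3$.
   Context: For integers $m,n \geq 2$, the Turk's Head link $THK(m,n)$ is the link obtained by taking the standard braid representation of the $(m,n)$ torus link on $m$ strands and making it alternating; that is, it is the closure of the $m$-strand braid $\left(\sigma_1 \sigma_2^{-1} \sigma_3 \sigma_4^{-1} \cdots \sigma_{m-1}^{\pm 1}\right)^n$, where $\sigma_i$ are the standard braid generators and the exponent of $\sigma_i$ in each block is $+1$ for $i$ odd and $-1$ for $i$ even. It has $\gcd(m,n)$ components, so it is a knot exactly when $\gcd(m,n)=1$. The determinant of a link is the usual link determinant (a non-negative integer, $|\Delta(-1)|$ with $\Delta$ the Alexander polynomial); for an alternating diagram of the link it equals the number of spanning trees of a checkerboard graph of the diagram (one vertex for each shaded region of the checkerboard shading, one edge for each crossing joining the two shaded regions that meet at it). *)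

theory Defs
  imports
    "HOL-Computational_Algebra.Polynomial_Factorial"
    "Jordan_Normal_Form.Determinant"
begin

section \<open>Braid words and closed braids\<close>

text \<open>
  The letter \<open>(i, True)\<close> is the generator \<open>\<sigma>\<^sub>i\<close> and \<open>(i, False)\<close> is its inverse. A braid on
  \<open>m\<close> strands uses \<open>1 \<le> i < m\<close>. All strands run upwards and the letters of a word are read
  from bottom to top. In \<open>\<sigma>\<^sub>i\<close> the strand going from position \<open>i\<close> to position \<open>i + 1\<close> is the
  overcrossing one; in \<open>\<sigma>\<^sub>i\<^sup>-\<^sup>1\<close> it is the strand going from position \<open>i + 1\<close> to position \<open>i\<close>.
\<close>

type_synonym braid_word = "(nat \<times> bool) list"

text \<open>A link is given as the closure of a braid, oriented along the strands.\<close>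

datatype closed_braid = Closure (strands: nat) (word: braid_word)

definition turks_head_block :: "nat \<Rightarrow> braid_word" where
  "turks_head_block m = map (\<lambda>i. (i, odd i)) [1..<m]"

definition THK :: "nat \<Rightarrow> nat \<Rightarrow> closed_braid" where
  "THK m n = Closure m (concat (replicate n (turks_head_block m)))"


section \<open>Arcs and crossings\<close>

text \<open>
  A crossing records its overcrossing arc and the two arcs ending at it, where left and right
  refer to the two sides of the oriented overcrossing arc.
\<close>

datatype crossing = Crossing (over_arc: nat) (left_arc: nat) (right_arc: nat)

text \<open>
  The arcs of the braid diagram, before closing it up, are numbered as follows: those starting
  at the bottom are \<open>0, \<dots>, m - 1\<close> from left to right, and the undercrossing strand of the
  \<open>k\<close>-th letter (counted from \<open>0\<close>) leaves its crossing as arc \<open>m + k\<close>. The function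
  \<open>sweep\<close> takes the number of the next new arc and the list of the arcs at the current height
  (position \<open>i\<close> is the list entry \<open>i - 1\<close>); it returns the crossings and the arcs at the top.
  In \<open>\<sigma>\<^sub>i\<close> the lower strand comes from the right of the upper one, in \<open>\<sigma>\<^sub>i\<^sup>-\<^sup>1\<close> from its left.
\<close>

fun sweep :: "nat \<Rightarrow> nat list \<Rightarrow> braid_word \<Rightarrow> crossing list \<times> nat list" where
  "sweep a s [] = ([], s)"
| "sweep a s ((i, True) # w) =
    (let (cs, s') = sweep (Suc a) (s[i - 1 := a, i := s ! (i - 1)]) w
     in (Crossing (s ! (i - 1)) a (s ! i) # cs, s'))"
| "sweep a s ((i, False) # w) =
    (let (cs, s') = sweep (Suc a) (s[i - 1 := s ! i, i := a]) w
     in (Crossing (s ! i) (s ! (i - 1)) a # cs, s'))"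

definition crossings :: "closed_braid \<Rightarrow> crossing list" where
  "crossings L = fst (sweep (strands L) [0..<strands L] (word L))"

definition top_arcs :: "closed_braid \<Rightarrow> nat list" where
  "top_arcs L = snd (sweep (strands L) [0..<strands L] (word L))"


section \<open>The Alexander polynomial and the determinant\<close>

text \<open>
  The link group has the Wirtinger presentation with one generator \<open>x\<^sub>j\<close> for each arc \<open>j\<close>, a
  relator \<open>x\<^sub>o x\<^sub>r x\<^sub>o\<^sup>-\<^sup>1 x\<^sub>l\<^sup>-\<^sup>1\<close> for each crossing with over, left and right arcs
  \<open>o\<close>, \<open>l\<close>, \<open>r\<close>, and, as the closure joins the top of every position to its bottom, a relator
  \<open>x\<^sub>u x\<^sub>j\<^sup>-\<^sup>1\<close> for the top arc \<open>u\<close> of each position with bottom arc \<open>j\<close>. The Alexander matrix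
  consists of the Fox derivatives of the relators (rows) by the generators (columns), with all
  \<open>x\<^sub>j\<close> sent to \<open>t\<close> (\<open>t_var\<close> below). All its entries lie in \<open>\<int>[t]\<close>.
\<close>

abbreviation t_var :: "int poly" where
  "t_var \<equiv> [:0, 1:]"

definition crossing_row :: "crossing \<Rightarrow> nat \<Rightarrow> int poly" where
  "crossing_row c j =
    of_bool (j = over_arc c) * (1 - t_var) + of_bool (j = right_arc c) * t_var - of_bool (j = left_arc c)"

definition closing_row :: "closed_braid \<Rightarrow> nat \<Rightarrow> nat \<Rightarrow> int poly" where
  "closing_row L i j = of_bool (j = top_arcs L ! i) - of_bool (j = i)"

definition alexander_matrix :: "closed_braid \<Rightarrow> int poly mat" where
  "alexander_matrix L =
    (let k = length (word L); d = k + strands L in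
     mat d d (\<lambda>(i, j). if i < k then crossing_row (crossings L ! i) j
                       else closing_row L (i - k) j))"

text \<open>
  The Alexander polynomial generates the smallest principal ideal of \<open>\<int>[t, t\<^sup>-\<^sup>1]\<close> containing the
  first elementary ideal of the Alexander matrix, that is, the ideal generated by the minors
  with one row and one column deleted. It is determined up to factors \<open>\<plusminus> t\<^sup>k\<close>. The greatest
  common divisor of these minors in \<open>\<int>[t]\<close> is a representative, and its absolute value at
  \<open>t = -1\<close> does not depend on the representative.
\<close>

definition alexander_polynomial :: "closed_braid \<Rightarrow> int poly" where
  "alexander_polynomial L =
    (let A = alexander_matrix L in
     Gcd {det (mat_delete A i j) | i j. i < dim_row A \<and> j < dim_col A})"

definition link_determinant :: "closed_braid \<Rightarrow> nat" where
  "link_determinant L = nat \<bar>poly (alexander_polynomial L) (-1)\<bar>"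


section \<open>Pell numbers\<close>

text \<open>The value \<open>pell 0\<close> extends the recurrence downwards, so that \<open>pell 2 = 2\<close>.\<close>

fun pell :: "nat \<Rightarrow> nat" where
  "pell 0 = 0"
| "pell (Suc 0) = 1"
| "pell (Suc (Suc n)) = 2 * pell (Suc n) + pell n"

end

theory Submission
  imports Defs
begin

text \<open>
  The determinant is read off from Fox colorings. Two facts about an Alexander matrix \<open>A\<close> of any
  closed braid make all its first minors proportional. Every row sums to zero. The rows themselves
  satisfy a linear relation, because the product of the generators of the arcs met at a given
  height of the braid does not change when a crossing is passed, and the Fox derivative of this
  product telescopes from bottom to top (\<open>sweep_row_relation\<close>). In this relation the first closing
  row has coefficient \<open>1\<close>, so the minor without that row and without the column of arc \<open>0\<close>
  divides all the others and is the greatest common divisor, up to a unit. Hence no polynomial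
  has to be computed: the determinant of the link is the absolute value of that minor of the
  matrix at \<open>t = -1\<close> (\<open>link_determinant_eq_cofactor\<close>).

  At \<open>t = -1\<close> a crossing row says that the colors \<open>o\<close>, \<open>l\<close>, \<open>r\<close> of its arcs satisfy
  \<open>2 o = l + r\<close>. Up to sign, the minor is the determinant of a square matrix presenting the group
  generated by the arcs subject to these relations, the closing relations and the vanishing of
  arc \<open>0\<close>. If this group is cyclic of order \<open>P\<close>, generated by one of the arcs, then the
  determinant of the link is \<open>P\<close> (\<open>link_determinant_cyclic_colorings\<close>).

  For the closure of two blocks on \<open>m\<close> strands, put color \<open>0\<close> on the first arc at the bottom and a
  generator on the first arc between the blocks. Going from left to right, each pair of
  crossings (one in each block) determines the next colors, and the two blocks always carry colors
  with sum \<open>1\<close>: exchanging the blocks is a symmetry that replaces \<open>v\<close> by \<open>1 - v\<close>. All that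
  remains at the right end is one condition, that the strand that has crossed the
  whole block arrives with the color required by the other block. The difference of these two colors
  obeys the Pell recursion up to sign (\<open>color_difference_pell\<close>), so the group is cyclic and its
  order is the Pell number.
\<close>

section \<open>Minors of singular matrices\<close>

text \<open>
  Replace row \<open>i\<close> by the vector with entries \<open>v j'\<close> at \<open>j\<close> and \<open>- v j\<close> at \<open>j'\<close>. It is orthogonal
  to \<open>v\<close>, so the new matrix still kills \<open>v\<close> and its determinant vanishes; expansion along row \<open>i\<close>
  is the claim.
\<close>
lemma cofactor_kernel:
  fixes A :: "'a :: idom mat"
  assumes A: "A \<in> carrier_mat n n"
    and ker: "\<And>r. r < n \<Longrightarrow> (\<Sum>k<n. A $$ (r, k) * v k) = 0"
    and ij: "i < n" "j < n" "j' < n"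
  shows "v j' * cofactor A i j = v j * cofactor A i j'"
proof (cases "j = j' \<or> (\<forall>k<n. v k = 0)")
  case True
  then show ?thesis using ij by auto
next
  case False
  define b where "b k = of_bool (k = j) * v j' - of_bool (k = j') * v j" for k
  define B where "B = mat n n (\<lambda>(r, k). if r = i then b k else A $$ (r, k))"
  have B: "B \<in> carrier_mat n n" by (simp add: B_def)
  have cof: "cofactor B i k = cofactor A i k" if "k < n" for k
    unfolding cofactor_def
    by (intro arg_cong2[where f = "(*)"] arg_cong[where f = det] refl)
      (use A that in \<open>auto simp: B_def mat_delete_def intro!: eq_matI\<close>)
  have "(\<Sum>k<n. B $$ (r, k) * v k) = 0" if "r < n" for r
  proof (cases "r = i")
    case True
    have "(\<Sum>k<n. B $$ (r, k) * v k) =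
        (\<Sum>k<n. of_bool (k = j) * (v j' * v k)) - (\<Sum>k<n. of_bool (k = j') * (v j * v k))"
      unfolding sum_subtractf[symmetric] using True that
      by (intro sum.cong) (auto simp: B_def b_def algebra_simps)
    then show ?thesis using ij by simp
  next
    case False
    then show ?thesis using ker[OF that] that by (simp add: B_def)
  qed
  then have "B *\<^sub>v vec n v = 0\<^sub>v n"
    using B by (intro eq_vecI) (auto simp: scalar_prod_def atLeast0LessThan)
  moreover have "vec n v \<noteq> 0\<^sub>v n" using False by (metis index_vec index_zero_vec(1))
  ultimately have "det B = 0" unfolding det_0_iff_vec_prod_zero[OF B] by (intro exI[of _ "vec n v"]) auto
  then have "0 = (\<Sum>k<n. b k * cofactor A i k)"
    unfolding laplace_expansion_row[OF B ij(1)] using ij cof by (simp add: B_def)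
  also have "\<dots> = (\<Sum>k<n. of_bool (k = j) * (v j' * cofactor A i k)) -
      (\<Sum>k<n. of_bool (k = j') * (v j * cofactor A i k))"
    unfolding sum_subtractf[symmetric] by (simp add: b_def algebra_simps)
  finally show ?thesis using ij by simp
qed

lemma cofactor_transpose:
  fixes A :: "'a :: comm_ring_1 mat"
  assumes "A \<in> carrier_mat n n" "i < n" "j < n"
  shows "cofactor (transpose_mat A) j i = cofactor A i j"
proof -
  have "mat_delete (transpose_mat A) j i = transpose_mat (mat_delete A i j)"
    using assms by (auto simp: mat_delete_def intro!: eq_matI)
  then show ?thesis
    using det_transpose[OF mat_delete_carrier[OF assms(1)], of i j]
    by (simp add: cofactor_def add.commute)
qed

lemma cofactor_left_kernel:
  fixes A :: "'a :: idom mat"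
  assumes A: "A \<in> carrier_mat n n"
    and ker: "\<And>k. k < n \<Longrightarrow> (\<Sum>r<n. w r * A $$ (r, k)) = 0"
    and ij: "i < n" "i' < n" "j < n"
  shows "w i' * cofactor A i j = w i * cofactor A i' j"
proof -
  have "w i' * cofactor (transpose_mat A) j i = w i * cofactor (transpose_mat A) j i'"
  proof (rule cofactor_kernel)
    show "(\<Sum>k<n. transpose_mat A $$ (r, k) * w k) = 0" if "r < n" for r
      using ker[OF that] that A by (simp add: mult.commute)
  qed (use A ij in auto)
  then show ?thesis using cofactor_transpose[OF A] ij by simp
qed

section \<open>Determinants of matrices with cyclic cokernel\<close>

definition row_span :: "int mat \<Rightarrow> (nat \<Rightarrow> int) set" where
  "row_span A = {v. \<exists>x. \<forall>j<dim_col A. v j = (\<Sum>i<dim_row A. x i * A $$ (i, j))}"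

lemma row_span_combine:
  assumes "v \<in> row_span A" "v' \<in> row_span A"
  shows "(\<lambda>j. a * v j + b * v' j) \<in> row_span A"
proof -
  obtain x x' where x: "\<forall>j<dim_col A. v j = (\<Sum>i<dim_row A. x i * A $$ (i, j))"
    "\<forall>j<dim_col A. v' j = (\<Sum>i<dim_row A. x' i * A $$ (i, j))"
    using assms by (auto simp: row_span_def)
  then show ?thesis unfolding row_span_def
    by (intro CollectI exI[of _ "\<lambda>i. a * x i + b * x' i"])
      (simp add: sum_distrib_left sum.distrib algebra_simps)
qed

lemma row_in_row_span:
  assumes "i < dim_row A" "\<And>j. j < dim_col A \<Longrightarrow> v j = A $$ (i, j)"
  shows "v \<in> row_span A"
proof -
  have "v j = (\<Sum>r<dim_row A. of_bool (r = i) * A $$ (r, j))" if "j < dim_col A" for j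
    using assms that by simp
  then show ?thesis unfolding row_span_def
    by (intro CollectI exI[of _ "\<lambda>r. of_bool (r = i)"] allI impI)
qed

text \<open>
  The hypotheses say that the quotient of \<open>\<int>\<^sup>n\<close> by the rows of \<open>A\<close> is isomorphic to \<open>\<int> / P\<close>, by
  the map that sends the \<open>j\<close>-th basis vector to \<open>u j\<close>. That \<open>P\<close> divides the
  determinant follows on applying the adjugate matrix to \<open>A u\<close>, which is divisible by \<open>P\<close>, and
  looking at entry \<open>q\<close>. Conversely, the last two hypotheses list vectors of the row lattice that
  themselves form a matrix of determinant \<open>P\<close>.
\<close>
lemma abs_det_cyclic_cokernel:
  fixes A :: "int mat"
  assumes A: "A \<in> carrier_mat n n" and q: "q < n"
    and u_q: "u q = 1"
    and mod_P: "\<And>i. i < n \<Longrightarrow> P dvd (\<Sum>j<n. A $$ (i, j) * u j)"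
    and gen: "\<And>j. j < n \<Longrightarrow> (\<lambda>k. of_bool (k = j) - u j * of_bool (k = q)) \<in> row_span A"
    and tors: "(\<lambda>k. P * of_bool (k = q)) \<in> row_span A"
  shows "\<bar>det A\<bar> = \<bar>P\<bar>"
proof (rule zdvd_antisym_abs)
  have "(\<Sum>i<n. cofactor A i q * (\<Sum>j<n. A $$ (i, j) * u j)) =
      (\<Sum>j<n. (\<Sum>i<n. cofactor A i q * A $$ (i, j)) * u j)"
    by (simp add: sum_distrib_left sum_distrib_right mult.assoc) (rule sum.swap)
  also have "\<dots> = (\<Sum>j<n. of_bool (q = j) * (det A * u j))"
  proof (intro sum.cong refl)
    fix j assume "j \<in> {..<n}"
    then have "(adj_mat A * A) $$ (q, j) = (\<Sum>i<n. cofactor A i q * A $$ (i, j))"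
      using A q by (simp add: adj_mat_def scalar_prod_def atLeast0LessThan)
    then show "(\<Sum>i<n. cofactor A i q * A $$ (i, j)) * u j = of_bool (q = j) * (det A * u j)"
      using adj_mat(3)[OF A] \<open>j \<in> {..<n}\<close> q by auto
  qed
  also have "\<dots> = det A" using q u_q by simp
  finally show "P dvd det A"
    using mod_P by (metis (no_types, lifting) dvd_mult dvd_sum lessThan_iff)
next
  define W where "W = mat n n (\<lambda>(i, j). if i = q then P * of_bool (j = q)
    else of_bool (j = i) - u i * of_bool (j = q))"
  have W: "W \<in> carrier_mat n n" by (simp add: W_def)
  have "\<exists>x. \<forall>j<n. W $$ (i, j) = (\<Sum>r<n. x r * A $$ (r, j))" if "i < n" for i
    using gen[OF that] tors that A by (cases "i = q") (auto simp: row_span_def W_def)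
  then obtain x where x: "\<And>i j. i < n \<Longrightarrow> j < n \<Longrightarrow> W $$ (i, j) = (\<Sum>r<n. x i r * A $$ (r, j))"
    by metis
  have "W = mat n n (\<lambda>(i, r). x i r) * A"
    using W A x by (intro eq_matI) (auto simp: scalar_prod_def atLeast0LessThan)
  then have "det W = det (mat n n (\<lambda>(i, r). x i r)) * det A"
    using det_mult[OF _ A, of "mat n n (\<lambda>(i, r). x i r)"] by simp
  moreover have "det W = P"
  proof -
    have "mat_delete W q q = 1\<^sub>m (n - 1)"
      using q by (auto simp: mat_delete_def W_def intro!: eq_matI)
    then have "cofactor W q q = 1" by (simp add: cofactor_def)
    moreover have "det W = (\<Sum>j<n. of_bool (j = q) * (P * cofactor W q j))"
      unfolding laplace_expansion_row[OF W q] using q by (intro sum.cong) (auto simp: W_def)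
    ultimately show ?thesis using q by simp
  qed
  ultimately show "det A dvd P" by simp
qed

section \<open>Linear relations in the Alexander matrix of a closed braid\<close>

lemma length_sweep:
  "length (fst (sweep a s w)) = length w" "length (snd (sweep a s w)) = length s"
  by (induction a s w rule: sweep.induct) (auto simp: Let_def split: prod.splits)

definition braid_on :: "nat \<Rightarrow> braid_word \<Rightarrow> bool" where
  "braid_on m w \<longleftrightarrow> (\<forall>(i, e) \<in> set w. 1 \<le> i \<and> i < m)"

lemma sweep_arcs_less:
  assumes "braid_on (length s) w" "set s \<subseteq> {..<a}"
  shows "(\<forall>c \<in> set (fst (sweep a s w)).
      over_arc c < a + length w \<and> left_arc c < a + length w \<and> right_arc c < a + length w) \<and>
    set (snd (sweep a s w)) \<subseteq> {..<a + length w}"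
  using assms
proof (induction a s w rule: sweep.induct)
  case (2 a s i w)
  then have i: "1 \<le> i" "i < length s" by (auto simp: braid_on_def)
  have old: "s ! (i - 1) < a" "s ! i < a" using 2(3) i by (auto simp: subset_eq)
  have "set (s[i - 1 := a, i := s ! (i - 1)]) \<subseteq> {..<Suc a}"
    using old 2(3) by (auto dest!: set_update_subset_insert[THEN subsetD])
  then show ?case using 2(1) 2(2) old by (auto simp: braid_on_def Let_def split: prod.splits)
next
  case (3 a s i w)
  then have i: "1 \<le> i" "i < length s" by (auto simp: braid_on_def)
  have old: "s ! (i - 1) < a" "s ! i < a" using 3(3) i by (auto simp: subset_eq)
  have "set (s[i - 1 := s ! i, i := a]) \<subseteq> {..<Suc a}"
    using old 3(3) by (auto dest!: set_update_subset_insert[THEN subsetD])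
  then show ?case using 3(1) 3(2) old by (auto simp: braid_on_def Let_def split: prod.splits)
qed auto

text \<open>
  The Fox derivative, by the generator of arc \<open>j\<close>, of the product of the generators of the arcs \<open>s\<close>
  at one height, with all generators sent to \<open>t\<close>.
\<close>
definition level_sum :: "nat list \<Rightarrow> nat \<Rightarrow> int poly" where
  "level_sum s j = (\<Sum>p<length s. t_var ^ p * of_bool (j = s ! p))"

text \<open>
  The coefficient of a crossing row in the relation between the rows: the factors to the left of
  the crossing contribute the power of \<open>t\<close>, and the sign says whether passing the crossing upwards
  replaces \<open>x\<^sub>o x\<^sub>r\<close> by \<open>x\<^sub>l x\<^sub>o\<close> or conversely.
\<close>
definition letter_weight :: "nat \<times> bool \<Rightarrow> int poly" where
  "letter_weight l = (if snd l then 1 else -1) * t_var ^ (fst l - 1)"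

lemma level_sum_update:
  assumes "1 \<le> i" "i < length s"
  shows "level_sum s j - level_sum (s[i - 1 := x, i := y]) j =
    t_var ^ (i - 1) * (of_bool (j = s ! (i - 1)) + t_var * of_bool (j = s ! i)
      - of_bool (j = x) - t_var * of_bool (j = y))"
proof -
  obtain p where p: "i = Suc p" using assms by (cases i) auto
  let ?s = "s[p := x, i := y]"
  have split: "(\<Sum>k<length s. f k) = (\<Sum>k\<in>{..<length s} - {p, i}. f k) + f p + f i"
    for f :: "nat \<Rightarrow> int poly"
    using sum.subset_diff[of "{p, i}" "{..<length s}" f] assms p by (simp add: add.assoc)
  have "(\<Sum>k\<in>{..<length s} - {p, i}. t_var ^ k * of_bool (j = s ! k)) =
      (\<Sum>k\<in>{..<length s} - {p, i}. t_var ^ k * of_bool (j = ?s ! k))"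
    by (intro sum.cong) auto
  then show ?thesis
    unfolding level_sum_def using assms p
    by (simp add: split algebra_simps del: mult_pCons_left mult_pCons_right)
qed

text \<open>
  A crossing changes two neighbouring factors of the product of the generators at one height:
  \<open>x\<^sub>o x\<^sub>r\<close> becomes \<open>x\<^sub>l x\<^sub>o\<close> or conversely. These words differ by the relator of the crossing,
  so each step of the sweep changes the level sum by a multiple of one row.
\<close>
lemma sweep_row_relation:
  assumes "braid_on (length s) w"
  shows "(\<Sum>k<length w. letter_weight (w ! k) * crossing_row (fst (sweep a s w) ! k) j) =
    level_sum s j - level_sum (snd (sweep a s w)) j"
  using assms
proof (induction a s w rule: sweep.induct)
  case (2 a s i w)
  let ?s = "s[i - 1 := a, i := s ! (i - 1)]"
  have i: "1 \<le> i" "i < length s" using 2(2) by (auto simp: braid_on_def)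
  have w: "braid_on (length ?s) w" using 2(2) by (simp add: braid_on_def)
  have "level_sum s j - level_sum ?s j =
      letter_weight (i, True) * crossing_row (Crossing (s ! (i - 1)) a (s ! i)) j"
    unfolding level_sum_update[OF i]
    by (simp add: letter_weight_def crossing_row_def algebra_simps del: mult_pCons_left mult_pCons_right)
  then show ?case
    using 2(1)[OF w] by (simp add: sum.lessThan_Suc_shift split_beta Let_def del: sum.lessThan_Suc)
next
  case (3 a s i w)
  let ?s = "s[i - 1 := s ! i, i := a]"
  have i: "1 \<le> i" "i < length s" using 3(2) by (auto simp: braid_on_def)
  have w: "braid_on (length ?s) w" using 3(2) by (simp add: braid_on_def)
  have "level_sum s j - level_sum ?s j =
      letter_weight (i, False) * crossing_row (Crossing (s ! i) (s ! (i - 1)) a) j"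
    unfolding level_sum_update[OF i]
    by (simp add: letter_weight_def crossing_row_def algebra_simps del: mult_pCons_left mult_pCons_right)
  then show ?case
    using 3(1)[OF w] by (simp add: sum.lessThan_Suc_shift split_beta Let_def del: sum.lessThan_Suc)
qed (simp add: level_sum_def)

definition arc_count :: "closed_braid \<Rightarrow> nat" where
  "arc_count L = length (word L) + strands L"

lemma alexander_matrix_carrier:
  "alexander_matrix L \<in> carrier_mat (arc_count L) (arc_count L)"
  by (simp add: alexander_matrix_def arc_count_def Let_def)

lemma alexander_matrix_entry:
  assumes "r < arc_count L" "j < arc_count L"
  shows "alexander_matrix L $$ (r, j) =
    (if r < length (word L) then crossing_row (crossings L ! r) j
     else closing_row L (r - length (word L)) j)"
  using assms by (simp add: alexander_matrix_def arc_count_def Let_def)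

lemma arcs_less_arc_count:
  assumes "braid_on (strands L) (word L)"
  shows "c \<in> set (crossings L) \<Longrightarrow>
      over_arc c < arc_count L \<and> left_arc c < arc_count L \<and> right_arc c < arc_count L"
    and "i < strands L \<Longrightarrow> top_arcs L ! i < arc_count L"
  using sweep_arcs_less[of "[0..<strands L]" "word L" "strands L"] assms
    length_sweep(2)[of "strands L" "[0..<strands L]" "word L"]
  by (auto simp: crossings_def top_arcs_def arc_count_def add.commute subset_eq)

lemma length_crossings: "length (crossings L) = length (word L)"
  by (simp add: crossings_def length_sweep)

lemma length_top_arcs: "length (top_arcs L) = strands L"
  by (simp add: top_arcs_def length_sweep)

lemma alexander_row_sum:
  assumes w: "braid_on (strands L) (word L)" and r: "r < arc_count L"
  shows "(\<Sum>j<arc_count L. alexander_matrix L $$ (r, j)) = 0"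
proof (cases "r < length (word L)")
  case True
  then have "crossings L ! r \<in> set (crossings L)" by (simp add: length_crossings)
  from arcs_less_arc_count(1)[OF w this] show ?thesis
    using True r by (simp add: alexander_matrix_entry crossing_row_def sum.distrib sum_subtractf
        flip: sum_distrib_right del: mult_pCons_left mult_pCons_right)
next
  case False
  then have "r - length (word L) < strands L" using r by (simp add: arc_count_def)
  from arcs_less_arc_count(2)[OF w this] this show ?thesis
    using False r by (simp add: alexander_matrix_entry closing_row_def sum_subtractf)
qed

definition row_weight :: "closed_braid \<Rightarrow> nat \<Rightarrow> int poly" where
  "row_weight L r = (if r < length (word L) then letter_weight (word L ! r)
    else t_var ^ (r - length (word L)))"

text \<open>
  The product at the top and the product at the bottom are identified by the closing
  relators, which cancels what remains of the telescoping sum.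
\<close>
lemma alexander_row_relation:
  assumes w: "braid_on (strands L) (word L)" and j: "j < arc_count L"
  shows "(\<Sum>r<arc_count L. row_weight L r * alexander_matrix L $$ (r, j)) = 0"
proof -
  let ?k = "length (word L)" and ?m = "strands L"
  have split: "(\<Sum>r<?k + n. f r) = (\<Sum>r<?k. f r) + (\<Sum>p<n. f (?k + p))"
    for n and f :: "nat \<Rightarrow> int poly"
    by (induction n) (simp_all add: add.assoc)
  have "(\<Sum>r<arc_count L. row_weight L r * alexander_matrix L $$ (r, j)) =
      (\<Sum>r<?k. row_weight L r * alexander_matrix L $$ (r, j)) +
      (\<Sum>p<?m. row_weight L (?k + p) * alexander_matrix L $$ (?k + p, j))"
    by (simp add: arc_count_def split)
  also have "(\<Sum>r<?k. row_weight L r * alexander_matrix L $$ (r, j)) =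
      (\<Sum>r<?k. letter_weight (word L ! r) * crossing_row (crossings L ! r) j)"
    using j by (intro sum.cong) (auto simp: row_weight_def alexander_matrix_entry arc_count_def)
  also have "\<dots> = level_sum [0..<?m] j - level_sum (top_arcs L) j"
    using sweep_row_relation[of "[0..<?m]" "word L" ?m j] w
    by (simp add: crossings_def top_arcs_def)
  also have "(\<Sum>p<?m. row_weight L (?k + p) * alexander_matrix L $$ (?k + p, j)) =
      (\<Sum>p<?m. t_var ^ p * (of_bool (j = top_arcs L ! p) - of_bool (j = p)))"
    using j by (intro sum.cong)
      (auto simp: row_weight_def alexander_matrix_entry arc_count_def closing_row_def)
  also have "\<dots> = level_sum (top_arcs L) j - level_sum [0..<?m] j"
    by (simp add: level_sum_def length_top_arcs right_diff_distrib sum_subtractf)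
  finally show ?thesis by simp
qed

section \<open>The determinant as a minor at minus one\<close>

definition coloring_matrix :: "closed_braid \<Rightarrow> int mat" where
  "coloring_matrix L = map_mat (\<lambda>p. poly p (-1)) (alexander_matrix L)"

interpretation poly_at_minus_one: comm_ring_hom "\<lambda>p :: int poly. poly p (-1)"
  by unfold_locales simp_all

text \<open>
  The first closing row has coefficient \<open>t\<^sup>0 = 1\<close> in the relation between the rows, so its cofactors
  divide all others already in \<open>\<int>[t]\<close>, and no power of \<open>t\<close> has to be split off from the
  greatest common divisor.
\<close>
lemma link_determinant_eq_cofactor:
  assumes w: "braid_on (strands L) (word L)" and m: "strands L > 0"
  shows "link_determinant L = nat \<bar>cofactor (coloring_matrix L) (length (word L)) 0\<bar>"
proof -
  let ?A = "alexander_matrix L" and ?d = "arc_count L" and ?r = "length (word L)"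
  let ?M = "det (mat_delete ?A ?r 0)"
  let ?S = "{det (mat_delete ?A i j) | i j. i < dim_row ?A \<and> j < dim_col ?A}"
  note A = alexander_matrix_carrier[of L]
  have r: "?r < ?d" "0 < ?d" using m by (auto simp: arc_count_def)
  have sign: "p dvd (-1) ^ n * p' \<longleftrightarrow> p dvd p'" for p p' :: "int poly" and n
    by (simp add: minus_one_power_iff)
  have dvd: "?M dvd det (mat_delete ?A i j)" if "i < ?d" "j < ?d" for i j
  proof -
    have "row_weight L ?r * cofactor ?A i j = row_weight L i * cofactor ?A ?r j"
      using cofactor_left_kernel[OF A alexander_row_relation[OF w]] that r by simp
    moreover have "cofactor ?A ?r j = cofactor ?A ?r 0"
      using cofactor_kernel[OF A, of "\<lambda>_. 1" ?r 0 j] alexander_row_sum[OF w] that r by simp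
    ultimately have "cofactor ?A i j = row_weight L i * cofactor ?A ?r 0"
      by (simp add: row_weight_def)
    moreover have "?M dvd cofactor ?A ?r 0" by (simp add: cofactor_def)
    ultimately have "?M dvd cofactor ?A i j" by simp
    then show ?thesis by (simp only: cofactor_def sign)
  qed
  have at_minus_one: "poly p (-1) dvd poly p' (-1)" if "p dvd p'" for p p' :: "int poly"
    using that by (elim dvdE) simp
  have "?M \<in> ?S"
    by (intro CollectI exI[of _ ?r] exI[of _ 0] conjI refl) (use A r in simp_all)
  then have "Gcd ?S dvd ?M" by (rule Gcd_dvd)
  moreover have "?M dvd Gcd ?S"
  proof (rule Gcd_greatest)
    fix p assume "p \<in> ?S"
    then obtain i j where "p = det (mat_delete ?A i j)" "i < ?d" "j < ?d"
      unfolding carrier_matD[OF A] by blast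
    then show "?M dvd p" using dvd by blast
  qed
  ultimately have "poly (Gcd ?S) (-1) dvd poly ?M (-1)" "poly ?M (-1) dvd poly (Gcd ?S) (-1)"
    by (simp_all only: at_minus_one)
  then have "\<bar>poly (Gcd ?S) (-1)\<bar> = \<bar>poly ?M (-1)\<bar>" by (rule zdvd_antisym_abs)
  moreover have "poly ?M (-1) = det (mat_delete (coloring_matrix L) ?r 0)"
  proof -
    have "mat_delete (coloring_matrix L) ?r 0 = map_mat (\<lambda>p. poly p (-1)) (mat_delete ?A ?r 0)"
      using A r by (auto simp: coloring_matrix_def mat_delete_def intro!: eq_matI)
    then show ?thesis by simp
  qed
  ultimately show ?thesis
    by (simp add: link_determinant_def alexander_polynomial_def Let_def cofactor_def abs_mult power_abs)
qed

section \<open>Links with a cyclic group of colorings\<close>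

text \<open>
  The consequences of the coloring conditions at \<open>t = -1\<close>, with the arc \<open>0\<close> set to zero, as
  integer vectors indexed by the arcs. The inductive form allows color computations without
  reference to coefficients of a matrix.
\<close>
inductive_set coloring_relations :: "closed_braid \<Rightarrow> (nat \<Rightarrow> int) set" for L where
  crossing: "c \<in> set (crossings L) \<Longrightarrow> (\<lambda>k. 2 * of_bool (k = over_arc c)
    - of_bool (k = left_arc c) - of_bool (k = right_arc c)) \<in> coloring_relations L"
| closing: "i < strands L \<Longrightarrow>
    (\<lambda>k. of_bool (k = top_arcs L ! i) - of_bool (k = i)) \<in> coloring_relations L"
| base: "(\<lambda>k. of_bool (k = 0)) \<in> coloring_relations L"
| combine: "v \<in> coloring_relations L \<Longrightarrow> v' \<in> coloring_relations L \<Longrightarrow>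
    (\<lambda>k. a * v k + b * v' k) \<in> coloring_relations L"

text \<open>
  The cofactor that gives the determinant is the determinant of the matrix \<open>B\<close> in which the row of
  the first closing relation is replaced by the equation \<open>u 0 = 0\<close>. The replaced row is still in
  the row lattice of \<open>B\<close>, since its coefficient in the relation between the rows is \<open>1\<close>.
\<close>
lemma link_determinant_cyclic_colorings:
  assumes w: "braid_on (strands L) (word L)" and m: "strands L > 0"
    and q: "q < arc_count L"
    and u: "u 0 = 0" "u q = 1"
    and u_crossing: "\<And>c. c \<in> set (crossings L) \<Longrightarrow>
      P dvd 2 * u (over_arc c) - u (left_arc c) - u (right_arc c)"
    and u_closing: "\<And>i. i < strands L \<Longrightarrow> P dvd u (top_arcs L ! i) - u i"
    and gen: "\<And>j. j < arc_count L \<Longrightarrow>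
      (\<lambda>k. of_bool (k = j) - u j * of_bool (k = q)) \<in> coloring_relations L"
    and tors: "(\<lambda>k. P * of_bool (k = q)) \<in> coloring_relations L"
  shows "link_determinant L = nat \<bar>P\<bar>"
proof -
  let ?C = "coloring_matrix L" and ?d = "arc_count L" and ?r = "length (word L)"
  have C: "?C \<in> carrier_mat ?d ?d"
    using alexander_matrix_carrier[of L] by (simp add: coloring_matrix_def)
  have r: "?r < ?d" "0 < ?d" using m by (auto simp: arc_count_def)
  define B where "B = mat ?d ?d (\<lambda>(i, j). if i = ?r then of_bool (j = 0) else ?C $$ (i, j))"
  have B: "B \<in> carrier_mat ?d ?d" by (simp add: B_def)
  have C_crossing: "?C $$ (i, j) = 2 * of_bool (j = over_arc (crossings L ! i))
      - of_bool (j = left_arc (crossings L ! i)) - of_bool (j = right_arc (crossings L ! i))"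
    if "i < ?r" "j < ?d" for i j
    using that alexander_matrix_carrier[of L]
    by (auto simp: coloring_matrix_def alexander_matrix_entry crossing_row_def arc_count_def)
  have C_closing: "?C $$ (?r + i, j) = of_bool (j = top_arcs L ! i) - of_bool (j = i)"
    if "i < strands L" "j < ?d" for i j
    using that alexander_matrix_carrier[of L]
    by (auto simp: coloring_matrix_def alexander_matrix_entry closing_row_def arc_count_def)
  have "det B = cofactor ?C ?r 0"
  proof -
    have "cofactor B ?r 0 = cofactor ?C ?r 0"
      unfolding cofactor_def
      by (intro arg_cong2[where f = "(*)"] arg_cong[where f = det] refl)
        (use C r in \<open>auto simp: B_def mat_delete_def intro!: eq_matI\<close>)
    moreover have "det B = (\<Sum>j<?d. of_bool (j = 0) * cofactor B ?r j)"
      unfolding laplace_expansion_row[OF B r(1)] using r by (simp add: B_def)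
    ultimately show ?thesis using r by simp
  qed
  moreover have "\<bar>det B\<bar> = \<bar>P\<bar>"
  proof (rule abs_det_cyclic_cokernel[where u = u, OF B q u(2)])
    fix i assume i: "i < ?d"
    consider "i = ?r" | "i < ?r" | p where "i = ?r + p" "i \<noteq> ?r" "p < strands L"
      using i by (metis arc_count_def linorder_neqE_nat nat_add_left_cancel_less less_imp_add_positive)
    then show "P dvd (\<Sum>j<?d. B $$ (i, j) * u j)"
    proof cases
      case 1
      have "(\<Sum>j<?d. B $$ (i, j) * u j) = (\<Sum>j<?d. of_bool (j = 0) * u j)"
        using 1 i by (intro sum.cong) (auto simp: B_def)
      then show ?thesis using i u by simp
    next
      case 2
      then have c: "crossings L ! i \<in> set (crossings L)" by (simp add: length_crossings)
      have "(\<Sum>j<?d. B $$ (i, j) * u j) = (\<Sum>j<?d. of_bool (j = over_arc (crossings L ! i)) * (2 * u j)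
          - of_bool (j = left_arc (crossings L ! i)) * u j
          - of_bool (j = right_arc (crossings L ! i)) * u j)"
        using 2 i by (intro sum.cong) (auto simp: B_def C_crossing algebra_simps)
      then show ?thesis
        using arcs_less_arc_count(1)[OF w c] u_crossing[OF c] by (simp add: sum_subtractf)
    next
      case 3
      have "(\<Sum>j<?d. B $$ (i, j) * u j) = (\<Sum>j<?d. of_bool (j = top_arcs L ! p) * u j
          - of_bool (j = p) * u j)"
        using 3 i C_closing[OF 3(3)] by (intro sum.cong) (simp_all add: B_def left_diff_distrib)
      moreover have "p < ?d" using 3 by (simp add: arc_count_def)
      ultimately show ?thesis
        using arcs_less_arc_count(2)[OF w] u_closing 3 by (simp add: sum_subtractf)
    qed
  next
    have C_row: "v \<in> row_span B" if "i < ?d" "\<And>j. j < ?d \<Longrightarrow> v j = ?C $$ (i, j)" for v i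
    proof (cases "i = ?r")
      case False
      then show ?thesis using that B by (intro row_in_row_span[of i]) (auto simp: B_def)
    next
      case True
      \<comment> \<open>The row missing from \<open>B\<close> is minus the weighted sum of the other rows.\<close>
      let ?w = "\<lambda>i. poly (row_weight L i) (-1)"
      define x where "x i = (if i = ?r then 0 else - ?w i)" for i
      have "v j = (\<Sum>i<?d. x i * B $$ (i, j))" if j: "j < ?d" for j
      proof -
        have "0 = poly (\<Sum>i<?d. row_weight L i * alexander_matrix L $$ (i, j)) (-1)"
          using alexander_row_relation[OF w j] by simp
        also have "\<dots> = (\<Sum>i<?d. ?w i * ?C $$ (i, j))"
          using alexander_matrix_carrier[of L] j
          by (simp add: poly_sum coloring_matrix_def)
        also have "\<dots> = ?w ?r * ?C $$ (?r, j) + (\<Sum>i\<in>{..<?d} - {?r}. ?w i * ?C $$ (i, j))"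
          using r by (intro sum.remove) auto
        also have "(\<Sum>i\<in>{..<?d} - {?r}. ?w i * ?C $$ (i, j)) =
            - (\<Sum>i\<in>{..<?d} - {?r}. x i * B $$ (i, j))"
          unfolding sum_negf[symmetric] using j by (intro sum.cong) (auto simp: x_def B_def)
        also have "(\<Sum>i\<in>{..<?d} - {?r}. x i * B $$ (i, j)) = (\<Sum>i<?d. x i * B $$ (i, j))"
          using r by (subst (2) sum.remove[of _ ?r]) (auto simp: x_def)
        finally show ?thesis using that True \<open>\<And>j. j < ?d \<Longrightarrow> v j = ?C $$ (i, j)\<close>
          by (simp add: row_weight_def)
      qed
      then show ?thesis using B unfolding row_span_def by (intro CollectI exI[of _ x]) auto
    qed
    have span: "v \<in> row_span B" if "v \<in> coloring_relations L" for v
      using that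
    proof induction
      case (crossing c)
      then obtain i where "i < ?r" "c = crossings L ! i"
        by (metis in_set_conv_nth length_crossings)
      then show ?case using C_crossing by (intro C_row[of i]) (auto simp: arc_count_def)
    next
      case (closing i)
      then show ?case using C_closing by (intro C_row[of "?r + i"]) (auto simp: arc_count_def)
    next
      case base
      show ?case using B r by (intro row_in_row_span[of ?r]) (auto simp: B_def)
    next
      case (combine v v' a b)
      then show ?case by (intro row_span_combine)
    qed
    show "(\<lambda>k. of_bool (k = j) - u j * of_bool (k = q)) \<in> row_span B" if "j < ?d" for j
      using gen[OF that] by (rule span)
    show "(\<lambda>k. P * of_bool (k = q)) \<in> row_span B"
      using tors by (rule span)
  qed
  ultimately show ?thesis using link_determinant_eq_cofactor[OF w m] by simp
qed

section \<open>The arcs of the Turk's Head link with two blocks\<close>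

lemma sweep_append:
  "sweep a s (w @ w') =
    (fst (sweep a s w) @ fst (sweep (a + length w) (snd (sweep a s w)) w'),
     snd (sweep (a + length w) (snd (sweep a s w)) w'))"
  by (induction a s w rule: sweep.induct) (simp_all add: split_beta Let_def)

text \<open>
  In a block, one strand travels from the first to the last position. It goes over at the odd
  letters and under at the even ones, hence is renamed at every second crossing. This is the
  arc by which it arrives at position \<open>j\<close> (counted from \<open>0\<close>) when the block starts with new arc \<open>a\<close>
  and bottom arcs \<open>s\<close>.
\<close>
definition moving_arc :: "nat \<Rightarrow> nat list \<Rightarrow> nat \<Rightarrow> nat" where
  "moving_arc a s j = (if j < 2 then s ! 0 else a + 2 * (j div 2) - 1)"

text \<open>
  The arc that leaves the block at position \<open>j\<close>, for every position but the last.
\<close>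
definition exit_arc :: "nat \<Rightarrow> nat list \<Rightarrow> nat \<Rightarrow> nat" where
  "exit_arc a s j = (if even j then a + j else s ! Suc j)"

definition block_crossing :: "nat \<Rightarrow> nat list \<Rightarrow> nat \<Rightarrow> crossing" where
  "block_crossing a s j =
    (if even j then Crossing (moving_arc a s j) (a + j) (s ! Suc j)
     else Crossing (s ! Suc j) (moving_arc a s j) (a + j))"

text \<open>
  Before the letter with index \<open>j\<close> (counted from \<open>0\<close>), the positions to the left of \<open>j\<close> are
  finished, the travelling strand is at \<open>j\<close>, and everything to the right is untouched.
\<close>
lemma sweep_block_from:
  assumes "j \<le> n" "length s = Suc n"
  shows "sweep (a + j) (map (exit_arc a s) [0..<j] @ moving_arc a s j # drop (Suc j) s)
      (map (\<lambda>i. (i, odd i)) [Suc j..<Suc n]) =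
    (map (block_crossing a s) [j..<n], map (exit_arc a s) [0..<n] @ [moving_arc a s n])"
  using assms(1)
proof (induction rule: inc_induct)
  case base
  then show ?case using assms(2) by simp
next
  case (step j)
  let ?pre = "map (exit_arc a s) [0..<j]" and ?post = "drop (Suc (Suc j)) s"
  have state: "drop (Suc j) s = s ! Suc j # ?post"
    using step(2) assms(2) by (simp add: Cons_nth_drop_Suc)
  have letters: "[Suc j..<Suc n] = Suc j # [Suc (Suc j)..<Suc n]" "[j..<n] = j # [Suc j..<n]"
    using step(2) by (simp_all only: upt_conv_Cons Suc_less_eq)
  have entries: "(?pre @ x # y # zs) ! j = x" "(?pre @ x # y # zs) ! Suc j = y"
    "(?pre @ x # y # zs)[j := x', Suc j := y'] = ?pre @ x' # y' # zs" for x y x' y' zs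
    by (simp_all add: nth_append list_update_append)
  have IH: "sweep (Suc (a + j)) (?pre @ exit_arc a s j # moving_arc a s (Suc j) # ?post)
      (map (\<lambda>i. (i, odd i)) [Suc (Suc j)..<Suc n]) =
    (map (block_crossing a s) [Suc j..<n], map (exit_arc a s) [0..<n] @ [moving_arc a s n])"
    using step(3) by simp
  show ?case
  proof (cases "even j")
    case True
    then have "moving_arc a s (Suc j) = moving_arc a s j" "exit_arc a s j = a + j"
      by (auto simp: moving_arc_def exit_arc_def elim: evenE)
    then show ?thesis
      using IH True by (simp add: state letters entries block_crossing_def del: upt_Suc)
  next
    case False
    then have "moving_arc a s (Suc j) = a + j" "exit_arc a s j = s ! Suc j"
      by (auto simp: moving_arc_def exit_arc_def elim: oddE)
    then show ?thesis
      using IH False by (simp add: state letters entries block_crossing_def del: upt_Suc)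
  qed
qed

lemma sweep_turks_head_block:
  assumes "length s = Suc n"
  shows "sweep a s (turks_head_block (Suc n)) =
    (map (block_crossing a s) [0..<n], map (exit_arc a s) [0..<n] @ [moving_arc a s n])"
proof -
  have "moving_arc a s 0 # drop (Suc 0) s = s"
    using assms by (cases s) (simp_all add: moving_arc_def)
  then show ?thesis
    using sweep_block_from[of 0 n s a] assms by (simp add: turks_head_block_def)
qed

lemma length_turks_head_block: "length (turks_head_block (Suc n)) = n"
  by (simp add: turks_head_block_def)

definition middle_arcs :: "nat \<Rightarrow> nat list" where
  "middle_arcs n = map (\<lambda>j. if even j then Suc n + j else Suc j) [0..<n]
    @ [moving_arc (Suc n) [0..<Suc n] n]"

lemma THK_2_diagram:
  shows "strands (THK (Suc n) 2) = Suc n"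
    and "word (THK (Suc n) 2) = turks_head_block (Suc n) @ turks_head_block (Suc n)"
    and "crossings (THK (Suc n) 2) = map (block_crossing (Suc n) [0..<Suc n]) [0..<n]
      @ map (block_crossing (Suc (2 * n)) (middle_arcs n)) [0..<n]"
    and "top_arcs (THK (Suc n) 2) = map (exit_arc (Suc (2 * n)) (middle_arcs n)) [0..<n]
      @ [moving_arc (Suc (2 * n)) (middle_arcs n) n]"
proof -
  show st: "strands (THK (Suc n) 2) = Suc n"
    and w: "word (THK (Suc n) 2) = turks_head_block (Suc n) @ turks_head_block (Suc n)"
    by (simp_all add: THK_def numeral_2_eq_2)
  have mid: "map (exit_arc (Suc n) [0..<Suc n]) [0..<n] @ [moving_arc (Suc n) [0..<Suc n] n]
      = middle_arcs n"
    by (auto simp: middle_arcs_def exit_arc_def nth_append simp del: upt_Suc)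
  have len: "length (middle_arcs n) = Suc n" by (simp add: middle_arcs_def)
  have "sweep (Suc n) [0..<Suc n] (turks_head_block (Suc n) @ turks_head_block (Suc n)) =
      (map (block_crossing (Suc n) [0..<Suc n]) [0..<n]
        @ map (block_crossing (Suc (2 * n)) (middle_arcs n)) [0..<n],
       map (exit_arc (Suc (2 * n)) (middle_arcs n)) [0..<n]
        @ [moving_arc (Suc (2 * n)) (middle_arcs n) n])"
    using sweep_turks_head_block[of "[0..<Suc n]" n "Suc n"]
      sweep_turks_head_block[OF len, of "Suc (2 * n)"]
    by (simp add: sweep_append mid length_turks_head_block mult_2 del: upt_Suc)
  then show "crossings (THK (Suc n) 2) = map (block_crossing (Suc n) [0..<Suc n]) [0..<n]
      @ map (block_crossing (Suc (2 * n)) (middle_arcs n)) [0..<n]"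
    and "top_arcs (THK (Suc n) 2) = map (exit_arc (Suc (2 * n)) (middle_arcs n)) [0..<n]
      @ [moving_arc (Suc (2 * n)) (middle_arcs n) n]"
    unfolding crossings_def top_arcs_def st w by simp_all
qed

section \<open>The coloring and the Pell numbers\<close>

text \<open>
  The color of the travelling strand of the first block at position \<open>j\<close> and the color with which
  position \<open>j\<close> leaves that block; the corresponding colors of the second block are obtained by
  \<open>v \<mapsto> 1 - v\<close>. Both recursions express the condition that twice the color of the upper arc is the
  sum of the other two colors, solved for the arc that is new when one goes from left to right.
\<close>
fun moving_color :: "nat \<Rightarrow> int" and exit_color :: "nat \<Rightarrow> int" where
  "moving_color 0 = 0"
| "moving_color (Suc j) = (if even j then moving_color j else 2 * exit_color j - moving_color j)"
| "exit_color 0 = 1"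
| "exit_color (Suc j) = (if even j then 1 - 2 * moving_color j + exit_color j else 1 - exit_color j)"

text \<open>
  The sign \<open>e\<close> changes at every second position. The second equation makes the induction work: it
  determines the moving color itself, which enters the recursion for the difference. The index in it
  depends on the parity because the moving color is constant along two positions.
\<close>
lemma color_difference_pell:
  "\<exists>e \<in> {1, -1}. exit_color j - moving_color j = e * int (pell (Suc j)) \<and>
    1 - 2 * moving_color j = e * (if even j then int (pell (Suc (Suc j))) - int (pell (Suc j))
      else int (pell (Suc j)) - int (pell j))"
proof (induction j)
  case 0
  show ?case by simp
next
  case (Suc j)
  then obtain e where e: "e \<in> {1, -1}"
    "exit_color j - moving_color j = e * int (pell (Suc j))"
    "1 - 2 * moving_color j = e * (if even j then int (pell (Suc (Suc j))) - int (pell (Suc j))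
      else int (pell (Suc j)) - int (pell j))"
    by blast
  show ?case
  proof (cases "even j")
    case True
    then show ?thesis using e by (intro bexI[of _ e]) auto
  next
    case False
    then show ?thesis using e by (intro bexI[of _ "- e"]) auto
  qed
qed

definition new_arc_color :: "nat \<Rightarrow> int" where
  "new_arc_color k = (if even k then exit_color k else moving_color (Suc k))"

text \<open>
  The arcs are numbered in three groups: the \<open>n + 1\<close> arcs at the bottom, the \<open>n\<close> new arcs of the
  first block, and the \<open>n\<close> new arcs of the second. The bottom arcs leave the second block, which
  explains the complementary colors of the first group.
\<close>
definition arc_color :: "nat \<Rightarrow> nat \<Rightarrow> int" where
  "arc_color n j = (if j \<le> n then 1 - exit_color j
    else if j \<le> 2 * n then new_arc_color (j - Suc n)
    else 1 - new_arc_color (j - Suc (2 * n)))"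

lemma arc_color_new:
  "k < n \<Longrightarrow> arc_color n (Suc n + k) = new_arc_color k"
  "arc_color n (Suc (2 * n) + k) = 1 - new_arc_color k"
  by (simp_all add: arc_color_def)

lemma moving_color_even_part: "moving_color (2 * (j div 2)) = moving_color j"
  by (cases "even j") (auto elim!: oddE)

lemma middle_arcs_nth:
  "j < n \<Longrightarrow> middle_arcs n ! j = (if even j then Suc n + j else Suc j)"
  "middle_arcs n ! n = moving_arc (Suc n) [0..<Suc n] n"
  by (simp_all add: middle_arcs_def nth_append del: upt_Suc)

lemma new_moving_arc_color:
  assumes "2 \<le> j" "j \<le> n"
  shows "new_arc_color (2 * (j div 2) - 1) = moving_color j" "2 * (j div 2) - 1 < n"
proof -
  obtain k where "2 * (j div 2) = Suc k" "odd k" using assms(1)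
    by (cases "2 * (j div 2)") (auto, metis even_Suc even_mult_iff even_numeral)
  then show "new_arc_color (2 * (j div 2) - 1) = moving_color j"
    using moving_color_even_part[of j] by (simp add: new_arc_color_def)
qed (use assms in auto)

lemma arc_color_moving:
  assumes "0 < n" "j \<le> n"
  shows "arc_color n (moving_arc (Suc n) [0..<Suc n] j) = moving_color j"
    and "arc_color n (moving_arc (Suc (2 * n)) (middle_arcs n) j) = 1 - moving_color j"
proof -
  have small: "moving_color j = 0" if "j < 2" using that by (cases j) auto
  have first: "moving_arc (Suc n) [0..<Suc n] j = (if j < 2 then 0 else Suc n + (2 * (j div 2) - 1))"
    by (auto simp: moving_arc_def simp del: upt_Suc)
  have second: "moving_arc (Suc (2 * n)) (middle_arcs n) j =
      (if j < 2 then Suc n else Suc (2 * n) + (2 * (j div 2) - 1))"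
    using assms by (auto simp: moving_arc_def middle_arcs_nth)
  have "arc_color n 0 = 0" "arc_color n (Suc n) = 1"
    using arc_color_new(1)[of 0 n] assms by (simp_all add: arc_color_def new_arc_color_def)
  note start = this
  show "arc_color n (moving_arc (Suc n) [0..<Suc n] j) = moving_color j"
    and "arc_color n (moving_arc (Suc (2 * n)) (middle_arcs n) j) = 1 - moving_color j"
  proof (atomize (full), cases "j < 2")
    case True
    then show "arc_color n (moving_arc (Suc n) [0..<Suc n] j) = moving_color j \<and>
        arc_color n (moving_arc (Suc (2 * n)) (middle_arcs n) j) = 1 - moving_color j"
      unfolding first second using start small by simp
  next
    case False
    then have k: "new_arc_color (2 * (j div 2) - 1) = moving_color j" "2 * (j div 2) - 1 < n"
      using new_moving_arc_color[of j n] assms by simp_all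
    show "arc_color n (moving_arc (Suc n) [0..<Suc n] j) = moving_color j \<and>
        arc_color n (moving_arc (Suc (2 * n)) (middle_arcs n) j) = 1 - moving_color j"
      unfolding first second using False k(1) arc_color_new(1)[OF k(2)] arc_color_new(2)[of n]
      by (simp only: if_False)
  qed
qed

text \<open>
  Equality holds except at the last position, where the travelling strand leaves the first block with
  the moving color.
\<close>
lemma arc_color_middle:
  assumes "j \<le> n" "0 < n"
  shows "(exit_color n - moving_color n) dvd arc_color n (middle_arcs n ! j) - exit_color j"
proof (cases "j = n")
  case True
  then show ?thesis
    using arc_color_moving(1)[OF assms(2), of n] by (simp add: middle_arcs_nth dvd_diff_commute)
next
  case False
  then have j: "j < n" using assms by simp
  have "arc_color n (middle_arcs n ! j) = exit_color j"
  proof (cases "even j")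
    case True
    then show ?thesis using arc_color_new(1)[OF j] j by (simp add: middle_arcs_nth new_arc_color_def)
  next
    case False
    then show ?thesis using j by (simp add: middle_arcs_nth arc_color_def)
  qed
  then show ?thesis by simp
qed

lemma arc_color_crossing:
  assumes n: "0 < n" and c: "c \<in> set (crossings (THK (Suc n) 2))"
  shows "(exit_color n - moving_color n) dvd
    2 * arc_color n (over_arc c) - arc_color n (left_arc c) - arc_color n (right_arc c)"
proof -
  let ?P = "exit_color n - moving_color n"
  obtain j where j: "j < n" and "c = block_crossing (Suc n) [0..<Suc n] j
      \<or> c = block_crossing (Suc (2 * n)) (middle_arcs n) j"
    using c by (auto simp: THK_2_diagram)
  then consider "c = block_crossing (Suc n) [0..<Suc n] j"
    | "c = block_crossing (Suc (2 * n)) (middle_arcs n) j" by blast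
  then show ?thesis
  proof cases
    case 1
    have "arc_color n (Suc j) = 1 - exit_color (Suc j)" using j by (simp add: arc_color_def)
    moreover have "[0..<Suc n] ! Suc j = Suc j" using j by (simp del: upt_Suc)
    ultimately show ?thesis
      using arc_color_moving(1)[OF n, of j] arc_color_new(1)[OF j] j
      unfolding 1 block_crossing_def by (simp add: new_arc_color_def del: upt_Suc)
  next
    case 2
    obtain t where "arc_color n (middle_arcs n ! Suc j) = exit_color (Suc j) + ?P * t"
      using arc_color_middle[of "Suc j" n] j n by (auto elim!: dvdE simp: algebra_simps)
    moreover have "?P dvd - (?P * t)" "?P dvd 2 * (?P * t)" by simp_all
    ultimately show ?thesis
      using arc_color_moving(2)[OF n, of j] arc_color_new(2)[of n j] j
      unfolding 2 block_crossing_def by (simp add: new_arc_color_def)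
  qed
qed

lemma arc_color_closing:
  assumes n: "0 < n" and i: "i \<le> n"
  shows "(exit_color n - moving_color n) dvd
    arc_color n (top_arcs (THK (Suc n) 2) ! i) - arc_color n i"
proof (cases "i = n")
  case True
  then show ?thesis
    using arc_color_moving(2)[OF n, of n] by (simp add: THK_2_diagram nth_append arc_color_def)
next
  case False
  then have j: "i < n" using i by simp
  then have top: "top_arcs (THK (Suc n) 2) ! i = exit_arc (Suc (2 * n)) (middle_arcs n) i"
    by (simp add: THK_2_diagram nth_append)
  show ?thesis
  proof (cases "even i")
    case True
    then show ?thesis
      using j arc_color_new(2)[of n i] by (simp add: top exit_arc_def arc_color_def new_arc_color_def)
  next
    case False
    then show ?thesis
      using j arc_color_middle[of "Suc i" n] n by (simp add: top exit_arc_def arc_color_def)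
  qed
qed

section \<open>Every arc is a multiple of one generator\<close>

text \<open>
  The color of arc \<open>j\<close> is \<open>v\<close> times the color of arc \<open>q\<close> in every coloring that is zero on arc \<open>0\<close>.
\<close>
definition has_color :: "closed_braid \<Rightarrow> nat \<Rightarrow> nat \<Rightarrow> int \<Rightarrow> bool" where
  "has_color L q j v \<longleftrightarrow>
    (\<lambda>k. of_bool (k = j) - v * of_bool (k = q)) \<in> coloring_relations L"

lemma coloring_relations_combine3:
  assumes "v1 \<in> coloring_relations L" "v2 \<in> coloring_relations L" "v3 \<in> coloring_relations L"
    and "\<And>k. v k = a * v1 k + b * v2 k + c * v3 k"
  shows "v \<in> coloring_relations L"
proof -
  have "v = (\<lambda>k. 1 * (a * v1 k + b * v2 k) + c * v3 k)" using assms(4) by auto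
  then show ?thesis
    using coloring_relations.combine[OF coloring_relations.combine[OF assms(1,2), of a b] assms(3), of 1 c]
    by simp
qed

lemma has_color_right:
  assumes "Crossing x l r \<in> set (crossings L)" "has_color L q x a" "has_color L q l b"
  shows "has_color L q r (2 * a - b)"
  unfolding has_color_def
  by (rule coloring_relations_combine3[OF coloring_relations.crossing[OF assms(1)]
        assms(2,3)[unfolded has_color_def], of _ "-1" 2 "-1"]) (simp add: algebra_simps)

lemma has_color_closing:
  assumes "i < strands L"
  shows "has_color L q (top_arcs L ! i) v \<longleftrightarrow> has_color L q i v"
proof
  note c = coloring_relations.closing[OF assms]
  show "has_color L q i v" if "has_color L q (top_arcs L ! i) v"
    using that unfolding has_color_def
    by (intro coloring_relations_combine3[OF c c that[unfolded has_color_def], of _ "-1" 0 1])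
      (simp add: algebra_simps)
  show "has_color L q (top_arcs L ! i) v" if "has_color L q i v"
    using that unfolding has_color_def
    by (intro coloring_relations_combine3[OF c c that[unfolded has_color_def], of _ 1 0 1])
      (simp add: algebra_simps)
qed

lemma has_color_base: "has_color L q 0 0" "has_color L q q 1"
  using coloring_relations.base[of L]
    coloring_relations.combine[OF coloring_relations.base[of L] coloring_relations.base[of L], of 0 0]
  by (simp_all add: has_color_def)

text \<open>
  An arc with two colors forces their difference to annihilate the generator; this produces the
  order of the group.
\<close>
lemma has_color_unique:
  assumes "has_color L q j v" "has_color L q j v'"
  shows "(\<lambda>k. (v - v') * of_bool (k = q)) \<in> coloring_relations L"
  by (rule coloring_relations_combine3[OF assms[unfolded has_color_def]
        assms(1)[unfolded has_color_def], of _ "-1" 1 0]) (simp add: algebra_simps)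

text \<open>
  The four arcs at position \<open>j\<close> determine the four at position \<open>j + 1\<close>. At an even \<open>j\<close> the
  travelling strands are upper arcs and the crossings yield the strands below them; at an odd \<open>j\<close>
  they are lower arcs and the crossings yield their new names. At \<open>j = n\<close> the arc between
  the blocks gets the exit color as the second block requires it, although it is the same arc as
  the travelling one, with the moving color.
\<close>
lemma has_color_strands:
  assumes n: "0 < n" and "j \<le> n"
  defines "L \<equiv> THK (Suc n) 2" and "q \<equiv> Suc n"
  shows "has_color L q j (1 - exit_color j)
    \<and> has_color L q (middle_arcs n ! j) (exit_color j)
    \<and> has_color L q (moving_arc (Suc n) [0..<Suc n] j) (moving_color j)
    \<and> has_color L q (moving_arc (Suc (2 * n)) (middle_arcs n) j) (1 - moving_color j)"
  using assms(2)
proof (induction j)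
  case 0
  show ?case
    using has_color_base[of L q] n by (simp add: moving_arc_def middle_arcs_nth q_def del: upt_Suc)
next
  case (Suc j)
  then have j: "j < n" and IH: "has_color L q j (1 - exit_color j)"
    "has_color L q (middle_arcs n ! j) (exit_color j)"
    "has_color L q (moving_arc (Suc n) [0..<Suc n] j) (moving_color j)"
    "has_color L q (moving_arc (Suc (2 * n)) (middle_arcs n) j) (1 - moving_color j)"
    by auto
  have cross: "block_crossing (Suc n) [0..<Suc n] j \<in> set (crossings L)"
    "block_crossing (Suc (2 * n)) (middle_arcs n) j \<in> set (crossings L)"
    using j by (auto simp: L_def THK_2_diagram)
  have top: "has_color L q (exit_arc (Suc (2 * n)) (middle_arcs n) j) (1 - exit_color j)"
    using has_color_closing[of j L q] IH(1) j by (simp add: L_def THK_2_diagram nth_append)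
  have bottom: "[0..<Suc n] ! Suc j = Suc j" using j by (simp del: upt_Suc)
  show ?case
  proof (cases "even j")
    case True
    have c: "Crossing (moving_arc (Suc n) [0..<Suc n] j) (middle_arcs n ! j) (Suc j)
        \<in> set (crossings L)"
      "Crossing (moving_arc (Suc (2 * n)) (middle_arcs n) j)
        (exit_arc (Suc (2 * n)) (middle_arcs n) j) (middle_arcs n ! Suc j) \<in> set (crossings L)"
      using cross True j by (simp_all add: block_crossing_def bottom middle_arcs_nth exit_arc_def del: upt_Suc)
    have "moving_arc a s (Suc j) = moving_arc a s j" for a s
      using True by (auto simp: moving_arc_def elim: evenE)
    then show ?thesis
      using has_color_right[OF c(1) IH(3,2)] has_color_right[OF c(2) IH(4) top] IH(3,4) True
      by (simp add: algebra_simps)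
  next
    case False
    have next_arc: "moving_arc a s (Suc j) = a + j" for a s
      using False by (auto simp: moving_arc_def elim: oddE)
    have c: "Crossing (Suc j) (moving_arc (Suc n) [0..<Suc n] j) (Suc n + j) \<in> set (crossings L)"
      "Crossing (middle_arcs n ! Suc j) (moving_arc (Suc (2 * n)) (middle_arcs n) j)
        (Suc (2 * n) + j) \<in> set (crossings L)"
      using cross False j by (simp_all add: block_crossing_def bottom del: upt_Suc)
    have lower: "has_color L q (Suc j) (exit_color j)"
      using IH(2) False j by (simp add: middle_arcs_nth)
    have upper: "has_color L q (middle_arcs n ! Suc j) (1 - exit_color j)"
      using top False by (simp add: exit_arc_def)
    show ?thesis
      using has_color_right[OF c(1) lower IH(3)] has_color_right[OF c(2) upper IH(4)]
        lower upper False
      by (simp add: next_arc algebra_simps)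
  qed
qed

lemma has_color_arc_color:
  assumes n: "0 < n" and j: "j < Suc (3 * n)"
  shows "has_color (THK (Suc n) 2) (Suc n) j (arc_color n j)"
proof -
  note strand = has_color_strands[OF n]
  have odd_arc: "moving_arc a s (Suc k) = a + k" if "odd k" for a s k
    using that by (auto simp: moving_arc_def elim: oddE)
  consider "j \<le> n" | k where "j = Suc n + k" "k < n" | k where "j = Suc (2 * n) + k" "k < n"
  proof -
    have "j \<le> n \<or> (j = Suc n + (j - Suc n) \<and> j - Suc n < n)
        \<or> (j = Suc (2 * n) + (j - Suc (2 * n)) \<and> j - Suc (2 * n) < n)"
      using j by arith
    then show ?thesis using that by blast
  qed
  then show ?thesis
  proof cases
    case 1
    then show ?thesis using strand[of j] by (simp add: arc_color_def)
  next
    case 2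
    then show ?thesis
      using strand[of k] strand[of "Suc k"] arc_color_new(1)[of k n]
      by (cases "even k") (simp_all add: new_arc_color_def middle_arcs_nth odd_arc)
  next
    case 3
    have "has_color (THK (Suc n) 2) (Suc n) j (1 - exit_color k)" if "even k"
      using has_color_closing[of k "THK (Suc n) 2" "Suc n"] strand[of k] 3 that
      by (simp add: THK_2_diagram nth_append exit_arc_def)
    then show ?thesis
      using 3 strand[of "Suc k"] arc_color_new(2)[of n k]
      by (cases "even k") (simp_all add: new_arc_color_def odd_arc)
  qed
qed

theorem theorem2:
  fixes m :: nat
  assumes "m \<ge> 3"
  shows "link_determinant (THK m 2) = pell m"
proof -
  obtain n where m: "m = Suc n" and n: "0 < n" using assms by (cases m) auto
  let ?L = "THK (Suc n) 2" and ?P = "exit_color n - moving_color n"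
  have arcs: "arc_count ?L = Suc (3 * n)"
    by (simp add: arc_count_def THK_2_diagram length_turks_head_block)
  have "link_determinant ?L = nat \<bar>?P\<bar>"
  proof (rule link_determinant_cyclic_colorings[where q = "Suc n" and u = "arc_color n"])
    show "braid_on (strands ?L) (word ?L)"
      by (auto simp: braid_on_def THK_2_diagram turks_head_block_def)
    show "strands ?L > 0" by (simp add: THK_2_diagram)
    show "Suc n < arc_count ?L" using n by (simp add: arcs)
    show "arc_color n 0 = 0" "arc_color n (Suc n) = 1"
      using arc_color_new(1)[of 0 n] n by (simp_all add: arc_color_def new_arc_color_def)
    show "?P dvd 2 * arc_color n (over_arc c) - arc_color n (left_arc c) - arc_color n (right_arc c)"
      if "c \<in> set (crossings ?L)" for c
      using arc_color_crossing[OF n that] .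
    show "?P dvd arc_color n (top_arcs ?L ! i) - arc_color n i" if "i < strands ?L" for i
      using arc_color_closing[OF n] that by (simp add: THK_2_diagram)
    show "(\<lambda>k. of_bool (k = j) - arc_color n j * of_bool (k = Suc n)) \<in> coloring_relations ?L"
      if "j < arc_count ?L" for j
      using has_color_arc_color[OF n, of j] that by (simp add: arcs has_color_def)
    have "has_color ?L (Suc n) (middle_arcs n ! n) (exit_color n)"
      "has_color ?L (Suc n) (middle_arcs n ! n) (moving_color n)"
      using has_color_strands[OF n order_refl] by (simp_all add: middle_arcs_nth)
    then show "(\<lambda>k. ?P * of_bool (k = Suc n)) \<in> coloring_relations ?L"
      by (rule has_color_unique)
  qed
  also have "\<bar>?P\<bar> = int (pell (Suc n))"
    using color_difference_pell[of n] by (auto simp: abs_mult)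
  finally show ?thesis by (simp add: m)
qed

end
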